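(* Let $X$ and $Y$ be Tychonoff spaces, let $X$ be a $\Delta$-space, and let $\varphi: X \to Y$ be a continuous surjection such that $\varphi(F)$ is an $F_{\sigma}$-set in $Y$ for every closed set $F \subset X$. Then $Y$ is also a $\Delta$-space.
   Context: A topological space $X$ is a $\Delta$-space if for every decreasing sequence $\{D_n: n \in \omega\}$ of subsets of $X$ with empty intersection there is a decreasing sequence $\{V_n: n \in \omega\}$ of open subsets of $X$, also with empty intersection, such that $D_n \subset V_n$ for every $n \in \omega$. An $F_\sigma$-set is a countable union of closed sets. *)

theory Defs
  imports "HOL-Analysis.Analysis"
begin

definition tychonoff_space :: "'a topology \<Rightarrow> bool" where
  "tychonoff_space X \<longleftrightarrow> completely_regular_space X \<and> Hausdorff_space X"

definition Delta_space :: "'a topology \<Rightarrow> bool" where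
  "Delta_space X \<longleftrightarrow>
     (\<forall>D :: nat \<Rightarrow> 'a set.
        (\<forall>n. D n \<subseteq> topspace X) \<and> decseq D \<and> (\<Inter>n. D n) = {} \<longrightarrow>
        (\<exists>V :: nat \<Rightarrow> 'a set.
           (\<forall>n. openin X (V n)) \<and> decseq V \<and> (\<Inter>n. V n) = {} \<and> (\<forall>n. D n \<subseteq> V n)))"

end

theory Submission
  imports Defs
begin

text \<open>
  Complementation turns the \<open>\<Delta>\<close>-property into a statement about closed covers: for a vanishing
  decreasing sequence \<open>D\<close> one looks for closed sets \<open>F n\<close> that increase to the whole space and
  satisfy \<open>F n \<inter> D n = {}\<close>. By \<open>Delta_spaceI_fsigma_cover\<close>, it is enough to cover the space by
  \<open>F\<^sub>\<sigma>\<close>-sets whose \<open>n\<close>-th member misses \<open>D n\<close>: exhausting each of them by closed sets and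
  taking finite unions along the diagonal produces closed sets that increase. In this relaxed form
  the property passes through \<open>\<phi>\<close>. Pull \<open>D\<close> back to \<open>X\<close>, take the closed cover that the
  \<open>\<Delta>\<close>-property of \<open>X\<close> provides, and push it forward: the images are \<open>F\<^sub>\<sigma>\<close>, they cover \<open>Y\<close>
  because \<open>\<phi>\<close> is onto, and the \<open>n\<close>-th one misses \<open>D n\<close> because the pullback of \<open>D n\<close>
  consists of whole fibres.
\<close>

text \<open>
  Write \<open>S i\<close> as the union of closed sets \<open>C i k\<close>. If \<open>i \<le> n\<close>, then \<open>C i k\<close> misses \<open>D i\<close> and
  hence the smaller set \<open>D n\<close>, so the complement of the finite union of the \<open>C i k\<close> with
  \<open>i, k \<le> n\<close> is an open set around \<open>D n\<close>. These complements shrink to the empty set because the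
  \<open>C i k\<close> together cover the space.
\<close>

lemma Delta_spaceI_fsigma_cover:
  fixes Y :: "'b topology"
  assumes cover: "\<And>D :: nat \<Rightarrow> 'b set.
      \<lbrakk>\<And>n. D n \<subseteq> topspace Y; decseq D; (\<Inter>n. D n) = {}\<rbrakk> \<Longrightarrow>
      \<exists>S. (\<forall>n. fsigma_in Y (S n) \<and> S n \<inter> D n = {}) \<and> (\<Union>n. S n) = topspace Y"
  shows "Delta_space Y"
  unfolding Delta_space_def
proof (intro allI impI, elim conjE)
  fix D :: "nat \<Rightarrow> 'b set"
  assume sub: "\<forall>n. D n \<subseteq> topspace Y" and dec: "decseq D" and empty: "(\<Inter>n. D n) = {}"
  then have "\<exists>S. (\<forall>n. fsigma_in Y (S n) \<and> S n \<inter> D n = {}) \<and> (\<Union>n. S n) = topspace Y"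
    by (intro cover) auto
  then obtain S where S: "\<And>n. fsigma_in Y (S n)" "\<And>n. S n \<inter> D n = {}"
    and S_cover: "(\<Union>n. S n) = topspace Y"
    by auto
  have "\<forall>i. \<exists>C :: nat \<Rightarrow> 'b set. (\<forall>k. closedin Y (C k)) \<and> (\<Union>k. C k) = S i"
  proof
    fix i
    show "\<exists>C :: nat \<Rightarrow> 'b set. (\<forall>k. closedin Y (C k)) \<and> (\<Union>k. C k) = S i"
      using S(1)[of i] unfolding fsigma_in_ascending by auto
  qed
  from choice[OF this] obtain C :: "nat \<Rightarrow> nat \<Rightarrow> 'b set"
    where C: "\<And>i k. closedin Y (C i k)" and C_Un: "\<And>i. (\<Union>k. C i k) = S i"
    by blast
  define W where "W n = topspace Y - (\<Union>i\<le>n. \<Union>k\<le>n. C i k)" for n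
  have "closedin Y (\<Union>k\<le>n. C i k)" for i n
    using C by (intro closedin_Union) auto
  then have "openin Y (W n)" for n
    unfolding W_def by (intro openin_diff closedin_Union) auto
  moreover have "decseq W"
    unfolding W_def by (rule decseq_SucI) (auto intro: le_SucI)
  moreover have "(\<Inter>n. W n) = {}"
  proof (rule equals0I)
    fix y assume y: "y \<in> (\<Inter>n. W n)"
    then have "y \<in> topspace Y"
      by (auto simp: W_def)
    then obtain i k where "y \<in> C i k"
      using S_cover C_Un by blast
    then have "y \<notin> W (max i k)"
      unfolding W_def by (auto intro: max.cobounded1 max.cobounded2)
    with y show False by blast
  qed
  moreover have "D n \<subseteq> W n" for n
  proof -
    have "C i k \<inter> D n = {}" if "i \<le> n" for i k
      using S(2)[of i] C_Un[of i] decseqD[OF dec that] by blast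
    with sub show ?thesis
      unfolding W_def by blast
  qed
  ultimately show "\<exists>V. (\<forall>n. openin Y (V n)) \<and> decseq V \<and> (\<Inter>n. V n) = {} \<and> (\<forall>n. D n \<subseteq> V n)"
    by blast
qed

theorem theorem2p1:
  fixes X :: "'a topology" and Y :: "'b topology" and \<phi> :: "'a \<Rightarrow> 'b"
  assumes "tychonoff_space X"
    and "tychonoff_space Y"
    and "Delta_space X"
    and "continuous_map X Y \<phi>"
    and "\<phi> ` topspace X = topspace Y"
    and "\<And>F. closedin X F \<Longrightarrow> fsigma_in Y (\<phi> ` F)"
  shows "Delta_space Y"
proof (rule Delta_spaceI_fsigma_cover)
  fix D :: "nat \<Rightarrow> 'b set"
  assume dec: "decseq D" and empty: "(\<Inter>n. D n) = {}"
  define E where "E n = {x \<in> topspace X. \<phi> x \<in> D n}" for n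
  have "\<forall>n. E n \<subseteq> topspace X"
    by (auto simp: E_def)
  moreover have "decseq E"
    using dec by (auto simp: E_def decseq_def)
  moreover have "(\<Inter>n. E n) = {}"
    using empty by (auto simp: E_def)
  ultimately have "\<exists>V. (\<forall>n. openin X (V n)) \<and> decseq V \<and> (\<Inter>n. V n) = {} \<and> (\<forall>n. E n \<subseteq> V n)"
    using assms(3)[unfolded Delta_space_def, rule_format, of E] by simp
  then obtain V where V: "\<And>n. openin X (V n)" "(\<Inter>n. V n) = {}" "\<And>n. E n \<subseteq> V n"
    by auto
  define S where "S n = \<phi> ` (topspace X - V n)" for n
  have "fsigma_in Y (S n)" for n
    unfolding S_def using V(1) by (intro assms(6)) auto
  moreover have "S n \<inter> D n = {}" for n
    using V(3)[of n] by (auto simp: S_def E_def)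
  moreover have "(\<Union>n. S n) = topspace Y"
  proof -
    have "(\<Union>n. S n) = \<phi> ` (topspace X - (\<Inter>n. V n))"
      by (auto simp: S_def)
    then show ?thesis
      using V(2) assms(5) by simp
  qed
  ultimately show "\<exists>S. (\<forall>n. fsigma_in Y (S n) \<and> S n \<inter> D n = {}) \<and> (\<Union>n. S n) = topspace Y"
    by blast
qed

end
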